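(* Let $k$ be a nonnegative integer, $n$ a positive integer, $x=(x_1,\dots,x_n)$ and $K=2k+1$. Then $$P^{\mathrm{B}_n}_{(k^n)}(x;1,0)=\sum_{y\in\mathbb{Z}^k}\det_{1\le i,j\le k}\Bigl((-1)^{y_i}\bigl(\dot e_{n-i+j-Ky_i}(x)+\dot e_{n+i+j-Ky_i-1}(x)\bigr)\Bigr)$$ and $$P^{\mathrm{BC}_n}_{(k^n)}(x;1,-1,0)=\sum_{y\in\mathbb{Z}^k}\det_{1\le i,j\le k}\Bigl((-1)^{y_i}\bigl(\dot e_{n-i+j-Ky_i}(x)-\dot e_{n+i+j-Ky_i}(x)\bigr)\Bigr).$$
   Context: $\dot e_r(x)=e_r(x_1,x_1^{-1},\dots,x_n,x_n^{-1})$ is the $r$-th elementary symmetric function in $2n$ variables, equal to $0$ for $r<0$ or $r>2n$. $(k^n)$ is the partition with $n$ parts equal to $k$. For $k=0$ the right-hand sides are $1$ (empty determinant). For a partition $\lambda$, $l(\lambda)$ is the number of parts and $m_i(\lambda)$ the multiplicity of parts equal to $i$; $(a;t)_m=\prod_{i=0}^{m-1}(1-at^i)$; $v_\lambda(t)=\frac{(t;t)_{n-l(\lambda)}}{(1-t)^{n-l(\lambda)}}\prod_{i\ge1}\frac{(t;t)_{m_i(\lambda)}}{(1-t)^{m_i(\lambda)}}$ (a polynomial in $t$, which is then evaluated at $t=1$). Let $W=S_n\ltimes(\mathbb{Z}/2\mathbb{Z})^n$ act on rational functions in $x$ by permuting the $x_i$ and by $x_i\mapsto x_i^{-1}$. For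 $l(\lambda)\le n$ the $\mathrm{BC}_n$ Hall–Littlewood polynomial is $$P^{\mathrm{BC}_n}_{\lambda}(x;t,s_1,s_2)=\frac{1}{(s_1s_2;t)_{n-l(\lambda)}v_\lambda(t)}\sum_{w\in W}w\Biggl(\prod_{i=1}^n x_i^{-\lambda_i}\frac{(1-s_1x_i)(1-s_2x_i)}{1-x_i^2}\prod_{1\le i<j\le n}\frac{(tx_i-x_j)(1-tx_ix_j)}{(x_i-x_j)(1-x_ix_j)}\Biggr),$$ and the $\mathrm{B}_n$ Hall–Littlewood polynomial is $P^{\mathrm{B}_n}_\lambda(x;t,s)=P^{\mathrm{BC}_n}_\lambda(x;t,s,-1)$. *)

theory Defs
  imports
    "HOL-Analysis.Elementary_Normed_Spaces"
    "HOL-Library.FuncSet"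
    "HOL-Combinatorics.Permutations"
    "HOL-Computational_Algebra.Polynomial"
    "Jordan_Normal_Form.Determinant"
begin

text \<open>
  The variables \<open>x\<^sub>1, \<dots>, x\<^sub>n\<close> are a family \<open>x :: nat \<Rightarrow> 'a\<close> of elements of a field, read at the
  indices \<open>1, \<dots>, n\<close>. A rational function is represented by its value as a function of \<open>x\<close>; this
  is meaningful only where the denominators do not vanish. As the field is arbitrary, it may be a
  field of rational functions, with \<open>x\<^sub>1, \<dots>, x\<^sub>n\<close> the indeterminates.
\<close>

definition edot :: "nat \<Rightarrow> (nat \<Rightarrow> 'a::field) \<Rightarrow> int \<Rightarrow> 'a" where
  \<comment> \<open>The pair \<open>(i, d)\<close> indexes the variable \<open>x\<^sub>i\<^sup>d\<close>. The range of subsets \<open>S\<close> is empty unless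
     \<open>0 \<le> r \<le> 2n\<close>.\<close>
  "edot n x r = (\<Sum>S | S \<subseteq> {1..n} \<times> {1, -1::int} \<and> int (card S) = r. \<Prod>(i, d)\<in>S. x i powi d)"

definition qpoch :: "'a::comm_ring_1 \<Rightarrow> 'a \<Rightarrow> nat \<Rightarrow> 'a" where
  "qpoch a t m = (\<Prod>i<m. 1 - a * t ^ i)"

text \<open>
  A partition is a function \<open>\<lambda> :: nat \<Rightarrow> nat\<close> whose parts are \<open>\<lambda> 1 \<ge> \<lambda> 2 \<ge> \<dots>\<close>, eventually zero;
  the value \<open>\<lambda> 0\<close> is irrelevant.
\<close>

definition part_length :: "(nat \<Rightarrow> nat) \<Rightarrow> nat" where
  "part_length lam = card {j. j \<ge> 1 \<and> lam j \<noteq> 0}"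

definition part_mult :: "(nat \<Rightarrow> nat) \<Rightarrow> nat \<Rightarrow> nat" where
  "part_mult lam i = card {j. j \<ge> 1 \<and> lam j = i}"

definition rect_part :: "nat \<Rightarrow> nat \<Rightarrow> nat \<Rightarrow> nat" where
  "rect_part k n = (\<lambda>j. if 1 \<le> j \<and> j \<le> n then k else 0)"

definition qfact_poly :: "nat \<Rightarrow> 'a::field poly" where
  \<comment> \<open>\<open>(t;t)\<^sub>m / (1-t)\<^sup>m\<close> as a polynomial in \<open>t\<close>; the division is exact, see below.\<close>
  "qfact_poly m = qpoch [:0, 1:] [:0, 1:] m div (1 - [:0, 1:]) ^ m"

definition hl_v :: "nat \<Rightarrow> (nat \<Rightarrow> nat) \<Rightarrow> 'a::field poly" where
  \<comment> \<open>Factors with \<open>m\<^sub>i(\<lambda>) = 0\<close> equal \<open>1\<close> and are omitted to keep the product finite.\<close>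
  "hl_v n lam = qfact_poly (n - part_length lam) *
     (\<Prod>i | i \<ge> 1 \<and> part_mult lam i \<noteq> 0. qfact_poly (part_mult lam i))"

definition hyperoct :: "nat \<Rightarrow> ((nat \<Rightarrow> nat) \<times> (nat \<Rightarrow> int)) set" where
  "hyperoct n = {p. p permutes {1..n}} \<times> ({1..n} \<rightarrow>\<^sub>E {1, -1})"

definition hyperoct_act ::
    "(nat \<Rightarrow> nat) \<times> (nat \<Rightarrow> int) \<Rightarrow> ((nat \<Rightarrow> 'a::field) \<Rightarrow> 'a) \<Rightarrow> (nat \<Rightarrow> 'a) \<Rightarrow> 'a" where
  "hyperoct_act = (\<lambda>(p, d) f x. f (\<lambda>i. x (p i) powi d i))"

definition hl_kernel ::
    "nat \<Rightarrow> (nat \<Rightarrow> nat) \<Rightarrow> 'a::field \<Rightarrow> 'a \<Rightarrow> 'a \<Rightarrow> (nat \<Rightarrow> 'a) \<Rightarrow> 'a" where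
  "hl_kernel n lam t s1 s2 x =
     (\<Prod>i=1..n. x i powi (- int (lam i)) * ((1 - s1 * x i) * (1 - s2 * x i) / (1 - x i ^ 2))) *
     (\<Prod>(i, j) | 1 \<le> i \<and> i < j \<and> j \<le> n.
        (t * x i - x j) * (1 - t * x i * x j) / ((x i - x j) * (1 - x i * x j)))"

definition hl_BC ::
    "nat \<Rightarrow> (nat \<Rightarrow> nat) \<Rightarrow> (nat \<Rightarrow> 'a::field) \<Rightarrow> 'a \<Rightarrow> 'a \<Rightarrow> 'a \<Rightarrow> 'a" where
  "hl_BC n lam x t s1 s2 =
     1 / (qpoch (s1 * s2) t (n - part_length lam) * poly (hl_v n lam) t) *
     (\<Sum>w\<in>hyperoct n. hyperoct_act w (hl_kernel n lam t s1 s2) x)"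

definition hl_B :: "nat \<Rightarrow> (nat \<Rightarrow> nat) \<Rightarrow> (nat \<Rightarrow> 'a::field) \<Rightarrow> 'a \<Rightarrow> 'a \<Rightarrow> 'a" where
  "hl_B n lam x t s = hl_BC n lam x t s (-1)"

text \<open>The determinant of \<open>(A i j)\<close> with \<open>1 \<le> i, j \<le> k\<close>, and \<open>\<int>\<^sup>k\<close> indexed by \<open>1, \<dots>, k\<close>.\<close>

definition det_upto :: "nat \<Rightarrow> (nat \<Rightarrow> nat \<Rightarrow> 'a::comm_ring_1) \<Rightarrow> 'a" where
  "det_upto k A = det (mat k k (\<lambda>(a, b). A (Suc a) (Suc b)))"

definition int_vecs :: "nat \<Rightarrow> (nat \<Rightarrow> int) set" where
  "int_vecs k = {1..k} \<rightarrow>\<^sub>E UNIV"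

lemma power_dvd_qpoch:
  fixes a :: "'a::comm_ring_1"
  shows "(1 - a) ^ m dvd qpoch a a m"
proof -
  have "1 - a dvd 1 - a * a ^ i" for i
    using one_diff_power_eq[of a "Suc i"] by (simp only: power_Suc dvd_triv_left)
  then have "(\<Prod>i<m. 1 - a) dvd (\<Prod>i<m. 1 - a * a ^ i)"
    by (intro prod_dvd_prod)
  then show ?thesis
    by (simp only: qpoch_def prod_constant card_lessThan)
qed

lemma qfact_poly_exact:
  "qfact_poly m * (1 - [:0, 1:]) ^ m = qpoch [:0, 1::'a::field:] [:0, 1:] m"
  unfolding qfact_poly_def by (rule dvd_div_mult_self[OF power_dvd_qpoch])

lemma edot_eq_0:
  assumes "r < 0 \<or> r > 2 * int n"
  shows "edot n x r = 0"
proof -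
  have card: "card S \<le> 2 * n" if "S \<subseteq> {1..n} \<times> {1, -1::int}" for S
  proof -
    have "card S \<le> card ({1..n} \<times> {1, -1::int})"
      using that by (intro card_mono) auto
    then show ?thesis by (simp add: card_cartesian_product)
  qed
  then have empty: "{S. S \<subseteq> {1..n} \<times> {1, -1::int} \<and> int (card S) = r} = {}"
  proof -
    have "False" if "S \<subseteq> {1..n} \<times> {1, -1::int}" "int (card S) = r" for S
      using card[OF that(1)] that(2) assms by linarith
    then show ?thesis by blast
  qed
  show ?thesis
    unfolding edot_def empty by simp
qed

text \<open>
  \<open>supp_sum f Y\<close> sums \<open>f\<close> over the points of \<open>Y\<close> where \<open>f\<close> does not vanish. In a sum over \<open>\<int>\<^sup>k\<close>
  of determinants whose \<open>i\<close>-th row involves only \<open>y\<^sub>i\<close> and vanishes when \<open>\<bar>y\<^sub>i\<bar>\<close> is large, there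
  are only finitely many such points.
\<close>

lemma finite_support_det_upto:
  fixes A :: "nat \<Rightarrow> nat \<Rightarrow> int \<Rightarrow> 'a::comm_ring_1"
  assumes "\<And>i j z. i \<in> {1..k} \<Longrightarrow> j \<in> {1..k} \<Longrightarrow> \<bar>z\<bar> > N \<Longrightarrow> A i j z = 0"
  shows "finite (support_on (int_vecs k) (\<lambda>y. det_upto k (\<lambda>i j. A i j (y i))))"
proof (rule finite_subset)
  show "finite ({1..k} \<rightarrow>\<^sub>E {-N..N})"
    by (intro finite_PiE) auto
  show "support_on (int_vecs k) (\<lambda>y. det_upto k (\<lambda>i j. A i j (y i))) \<subseteq> {1..k} \<rightarrow>\<^sub>E {-N..N}"
  proof
    fix y assume "y \<in> support_on (int_vecs k) (\<lambda>y. det_upto k (\<lambda>i j. A i j (y i)))"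
    then have y: "y \<in> int_vecs k" and nz: "det_upto k (\<lambda>i j. A i j (y i)) \<noteq> 0"
      by (auto simp: support_on_def)
    have "\<bar>y i\<bar> \<le> N" if i: "i \<in> {1..k}" for i
    proof (rule ccontr)
      assume "\<not> \<bar>y i\<bar> \<le> N"
      then have row0: "A i j (y i) = 0" if "j \<in> {1..k}" for j
        using assms[OF i that, of "y i"] by simp
      let ?M = "mat k k (\<lambda>(a, b). A (Suc a) (Suc b) (y (Suc a)))"
      have "(\<Prod>a = 0..<k. ?M $$ (a, p a)) = 0" if p: "p permutes {0..<k}" for p
      proof (rule prod_zero)
        have "i - 1 < k" "Suc (i - 1) = i" using i by auto
        moreover have "p (i - 1) < k"
          using permutes_in_image[OF p, of "i - 1"] \<open>i - 1 < k\<close> by simp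
        ultimately have "?M $$ (i - 1, p (i - 1)) = 0"
          using row0[of "Suc (p (i - 1))"] by simp
        then show "\<exists>a\<in>{0..<k}. ?M $$ (a, p a) = 0"
          using \<open>i - 1 < k\<close> by auto
      qed simp
      then have "(\<Sum>p | p permutes {0..<k}. signof p * (\<Prod>a = 0..<k. ?M $$ (a, p a))) = 0"
        by (intro sum.neutral ballI) (simp only: mem_Collect_eq mult_zero_right)
      then have "det ?M = 0"
        by (simp only: det_def dim_row_mat dim_col_mat simp_thms if_True)
      with nz show False by (simp add: det_upto_def)
    qed
    then have "y i \<in> {-N..N}" if "i \<in> {1..k}" for i
      using that by (simp add: abs_le_iff minus_le_iff)
    with y show "y \<in> {1..k} \<rightarrow>\<^sub>E {-N..N}"
      unfolding int_vecs_def PiE_iff by blast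
  qed
qed

end

theory Submission
  imports Defs
begin

text \<open>
  At \<open>t = 1\<close> the kernel splits over the variables, so both left-hand sides equal
  \<open>\<Prod>\<^sub>i (x\<^sub>i\<^bsup>-k\<^esup> + \<dots> + x\<^sub>i\<^bsup>k\<^esup>)\<close>. On the right, multilinearity moves the sum over \<open>y\<close> into the rows and gives
  \<open>det (E (j - i) \<plusminus> E (i + j - \<dots>))\<close> for \<open>E r = \<Sum>\<^sub>z (-1)\<^sup>z e\<^bsub>n+r-Kz\<^esub>\<close>, which is even and changes sign under
  \<open>r \<mapsto> r + K\<close>. Adding a variable replaces \<open>E r\<close> by \<open>(x + 1/x) E r + E (r - 1) + E (r + 1)\<close>, and by these
  two symmetries this multiplies the matrix by \<open>(x + 1/x) I + A\<close>, where \<open>A\<close> is tridiagonal with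
  a single \<open>1\<close> in a corner of its diagonal. For \<open>n = 0\<close> the matrix is the identity, so the determinant is a
  product of Chebyshev-like continuants, each equal to \<open>x\<^bsup>-k\<^esup> + \<dots> + x\<^bsup>k\<^esup>\<close>.
\<close>

section \<open>Tridiagonal determinants\<close>

definition tridiag :: "nat \<Rightarrow> (nat \<Rightarrow> 'a::comm_ring_1) \<Rightarrow> 'a mat" where
  "tridiag k d = mat k k (\<lambda>(a, b). if a = b then d a else if a = Suc b \<or> b = Suc a then 1 else 0)"

text \<open>The minus sign belongs to off-diagonal entries that are both 1; Euler's continuant, with
  a plus, has 1 and -1 there.\<close>

fun continuant :: "(nat \<Rightarrow> 'a::comm_ring_1) \<Rightarrow> nat \<Rightarrow> 'a" where
  "continuant d 0 = 1"
| "continuant d (Suc 0) = d 0"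
| "continuant d (Suc (Suc k)) = d (Suc k) * continuant d (Suc k) - continuant d k"

lemma tridiag_carrier [simp]: "tridiag k d \<in> carrier_mat k k"
  by (simp add: tridiag_def)

text \<open>Expand along the last row. The minor of its entry in column \<open>k\<close> is then
  expanded along its last column, whose only nonzero entry is the 1 at the bottom.\<close>

lemma det_tridiag: "det (tridiag k d) = continuant d k"
proof (induction d k rule: continuant.induct)
  case (1 d)
  show ?case by (simp add: tridiag_def det_dim_zero)
next
  case (2 d)
  show ?case by (subst det_single) (simp_all add: tridiag_def)
next
  case (3 d k)
  let ?T = "tridiag (Suc (Suc k)) d"
  have T: "?T \<in> carrier_mat (Suc (Suc k)) (Suc (Suc k))" by simp
  have last: "mat_delete ?T (Suc k) (Suc k) = tridiag (Suc k) d"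
    by (rule eq_matI) (auto simp: tridiag_def mat_delete_def)
  let ?D = "mat_delete ?T (Suc k) k"
  have D: "?D \<in> carrier_mat (Suc k) (Suc k)"
    by (simp add: mat_delete_def tridiag_def)
  have DD: "mat_delete ?D k k = tridiag k d"
    by (rule eq_matI) (auto simp: tridiag_def mat_delete_def)
  have Dcol: "?D $$ (a, k) = (if a = k then 1 else 0)" if "a < Suc k" for a
    using that by (auto simp: tridiag_def mat_delete_def)
  have "det ?D = (\<Sum>a<Suc k. ?D $$ (a, k) * cofactor ?D a k)"
    by (rule laplace_expansion_column[OF D]) simp
  also have "\<dots> = (\<Sum>a<Suc k. if a = k then cofactor ?D k k else 0)"
    by (rule sum.cong) (simp_all add: Dcol)
  also have "\<dots> = continuant d k"
    using 3 by (simp add: cofactor_def DD)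
  finally have detD: "det ?D = continuant d k" .
  have Trow: "?T $$ (Suc k, b) = (if b = Suc k then d (Suc k) else if b = k then 1 else 0)"
    if "b < Suc (Suc k)" for b
    using that by (auto simp: tridiag_def)
  have "det ?T = (\<Sum>b<Suc (Suc k). ?T $$ (Suc k, b) * cofactor ?T (Suc k) b)"
    by (rule laplace_expansion_row[OF T]) simp
  also have "\<dots> = (\<Sum>b<Suc (Suc k). (if b = Suc k then d (Suc k) * cofactor ?T (Suc k) (Suc k) else 0)
       + (if b = k then cofactor ?T (Suc k) k else 0))"
    by (rule sum.cong) (simp_all add: Trow)
  also have "\<dots> = d (Suc k) * cofactor ?T (Suc k) (Suc k) + cofactor ?T (Suc k) k"
    by (simp add: sum.distrib)
  also have "\<dots> = continuant d (Suc (Suc k))"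
    using 3 by (simp add: cofactor_def last detD)
  finally show ?case .
qed

lemma continuant_cong:
  "(\<And>a. a < k \<Longrightarrow> d a = d' a) \<Longrightarrow> continuant d k = continuant d' k"
  by (induction d k rule: continuant.induct) auto

text \<open>
  The boundary values \<open>m a (-1)\<close> and \<open>m a k\<close> are absorbed into the two corners of the tridiagonal
  matrix.
\<close>

lemma mat_mult_tridiag:
  fixes m :: "nat \<Rightarrow> int \<Rightarrow> 'a::comm_ring_1"
  assumes left: "\<And>a. a < k \<Longrightarrow> m a (-1) = \<alpha> * m a 0"
    and right: "\<And>a. a < k \<Longrightarrow> m a (int k) = \<beta> * m a (int k - 1)"
  shows "mat k k (\<lambda>(a, b). m a (int b)) *
      tridiag k (\<lambda>b. c + (if b = 0 then \<alpha> else 0) + (if Suc b = k then \<beta> else 0))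
    = mat k k (\<lambda>(a, b). c * m a (int b) + m a (int b - 1) + m a (int b + 1))"
    (is "?M * tridiag k ?d = ?R")
proof (rule eq_matI)
  fix a b assume "a < dim_row ?R" "b < dim_col ?R"
  then have a: "a < k" and b: "b < k" by auto
  have "(?M * tridiag k ?d) $$ (a, b) =
      (\<Sum>i<k. m a (int i) * (if i = b then ?d i else if i = Suc b \<or> b = Suc i then 1 else 0))"
    using a b by (simp add: tridiag_def scalar_prod_def lessThan_atLeast0)
  \<comment> \<open>The guard \<open>b \<noteq> 0\<close> is there because \<open>b - 1\<close> is
    truncated at 0 and would count the diagonal entry again.\<close>
  also have "\<dots> = (\<Sum>i<k. (if i = b then m a (int b) * ?d b else 0)
      + (if i = Suc b then m a (int b + 1) else 0)
      + (if b \<noteq> 0 \<and> i = b - 1 then m a (int b - 1) else 0))"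
  proof (rule sum.cong)
    fix i
    consider "i = b" | "i = Suc b" | "b = Suc i" | "i \<noteq> b" "i \<noteq> Suc b" "b \<noteq> Suc i" by blast
    then show "m a (int i) * (if i = b then ?d i else if i = Suc b \<or> b = Suc i then 1 else 0) =
      (if i = b then m a (int b) * ?d b else 0)
      + (if i = Suc b then m a (int b + 1) else 0)
      + (if b \<noteq> 0 \<and> i = b - 1 then m a (int b - 1) else 0)"
      by cases (auto simp: algebra_simps)
  qed simp
  also have "\<dots> = m a (int b) * ?d b + (if Suc b < k then m a (int b + 1) else 0)
      + (if b \<noteq> 0 then m a (int b - 1) else 0)"
    using b by (cases "b = 0") (simp_all add: sum.distrib less_imp_diff_less)
  also have "\<dots> = c * m a (int b) + m a (int b - 1) + m a (int b + 1)"
  proof -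
    have "m a (int b - 1) = \<alpha> * m a (int b)" if "b = 0"
      using left[OF a] that by simp
    moreover have "m a (int b + 1) = \<beta> * m a (int b)" if "Suc b = k"
      using right[OF a] that by (auto simp: add.commute)
    moreover have "Suc b < k \<longleftrightarrow> Suc b \<noteq> k"
      using b by auto
    \<comment> \<open>For \<open>k = 1\<close> both corner corrections fall on the same entry, hence
      four cases.\<close>
    ultimately show ?thesis
      by (cases "b = 0"; cases "Suc b = k") (simp_all add: algebra_simps)
  qed
  finally show "(?M * tridiag k ?d) $$ (a, b) = ?R $$ (a, b)"
    using a b by simp
qed (simp_all add: tridiag_def)

section \<open>Alternating sums and their symmetries\<close>

text \<open>For \<open>K \<noteq> 0\<close> this is the alternating sum for no variables: only the
  elementary symmetric function of degree 0 survives, which selects the \<open>z\<close> with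
  \<open>m = K * z\<close>.\<close>

definition alt_char :: "int \<Rightarrow> int \<Rightarrow> 'a::field" where
  "alt_char K m = (if K dvd m then (-1) powi (m div K) else 0)"

lemma alt_char_minus: "alt_char K (- m) = alt_char K m"
proof (cases "K dvd m")
  case True
  then obtain q where "m = K * q" by blast
  then show ?thesis
    by (cases "K = 0") (simp_all add: alt_char_def power_int_minus_one_minus flip: mult_minus_right)
qed (simp add: alt_char_def)

lemma alt_char_add_period: "K \<noteq> 0 \<Longrightarrow> alt_char K (m + K) = - alt_char K m"
  by (simp add: alt_char_def power_int_add)

text \<open>
  \<open>alt_conv K x n r\<close> is \<open>\<Sum>\<^sub>z (-1)\<^sup>z e\<^bsub>n+r-Kz\<^esub>(x)\<close>, built up one variable at a time; see
  \<open>sum_alternating_edot\<close> below.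
\<close>

primrec alt_conv :: "int \<Rightarrow> (nat \<Rightarrow> 'a::field) \<Rightarrow> nat \<Rightarrow> int \<Rightarrow> 'a" where
  "alt_conv K x 0 r = alt_char K r"
| "alt_conv K x (Suc n) r = (x (Suc n) + inverse (x (Suc n))) * alt_conv K x n r
     + alt_conv K x n (r - 1) + alt_conv K x n (r + 1)"

text \<open>The recurrence treats \<open>r - 1\<close> and \<open>r + 1\<close> alike, so evenness
  passes from \<open>n\<close> to \<open>Suc n\<close>.\<close>

lemma alt_conv_minus: "alt_conv K x n (- r) = alt_conv K x n r"
proof (induction n arbitrary: r)
  case (Suc n)
  have "alt_conv K x n (- r - 1) = alt_conv K x n (r + 1)"
    "alt_conv K x n (- r + 1) = alt_conv K x n (r - 1)"
    using Suc[of "r + 1"] Suc[of "r - 1"] by simp_all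
  then show ?case by (simp add: Suc)
qed (simp add: alt_char_minus)

lemma alt_conv_add_period:
  assumes "K \<noteq> 0"
  shows "alt_conv K x n (r + K) = - alt_conv K x n r"
proof (induction n arbitrary: r)
  case (Suc n)
  have "alt_conv K x n (r + K - 1) = - alt_conv K x n (r - 1)"
    "alt_conv K x n (r + K + 1) = - alt_conv K x n (r + 1)"
    using Suc[of "r + 1"] Suc[of "r - 1"] by (simp_all add: algebra_simps)
  then show ?case by (simp only: alt_conv.simps Suc) (simp add: algebra_simps)
qed (simp add: alt_char_add_period assms)

text \<open>Evenness combined with the sign change under a shift by \<open>K\<close>. It governs the
  right boundary column of the matrices, as evenness governs the left one.\<close>

lemma alt_conv_reflect:
  assumes "K \<noteq> 0"
  shows "alt_conv K x n (K - r) = - alt_conv K x n r"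
  using alt_conv_add_period[OF assms, of x n "- r"] by (simp add: alt_conv_minus)

text \<open>Zero is the only multiple of \<open>K\<close> in this range. With
  \<open>K = 2k + 1\<close> it contains all arguments occurring in the matrices, which are therefore
  identities for \<open>n = 0\<close>.\<close>

lemma alt_char_small: "\<bar>m\<bar> < K \<Longrightarrow> alt_char K m = (if m = 0 then 1 else 0)"
  using dvd_imp_le_int[of m K] by (auto simp: alt_char_def)

text \<open>Each new variable multiplies the matrix on the right by a tridiagonal one. Columns are
  indexed by integers so that the boundary columns -1 and \<open>k\<close> make sense.\<close>

lemma det_prod_tridiag:
  fixes m :: "nat \<Rightarrow> nat \<Rightarrow> int \<Rightarrow> 'a::field"
  assumes base: "\<And>a b. a < k \<Longrightarrow> b < k \<Longrightarrow> m 0 a (int b) = (if a = b then 1 else 0)"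
    and step: "\<And>n a r. m (Suc n) a r = c (Suc n) * m n a r + m n a (r - 1) + m n a (r + 1)"
    and left: "\<And>n a. a < k \<Longrightarrow> m n a (-1) = \<alpha> * m n a 0"
    and right: "\<And>n a. a < k \<Longrightarrow> m n a (int k) = \<beta> * m n a (int k - 1)"
  shows "det (mat k k (\<lambda>(a, b). m n a (int b))) = (\<Prod>i=1..n.
    continuant (\<lambda>b. c i + (if b = 0 then \<alpha> else 0) + (if Suc b = k then \<beta> else 0)) k)"
proof (induction n)
  case 0
  have "mat k k (\<lambda>(a, b). m 0 a (int b)) = 1\<^sub>m k"
    by (rule eq_matI) (auto simp: base)
  then show ?case by simp
next
  case (Suc n)
  have "mat k k (\<lambda>(a, b). m (Suc n) a (int b)) = mat k k (\<lambda>(a, b). m n a (int b)) *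
      tridiag k (\<lambda>b. c (Suc n) + (if b = 0 then \<alpha> else 0) + (if Suc b = k then \<beta> else 0))"
    by (subst mat_mult_tridiag) (simp_all add: left right step)
  then show ?case
    by (simp add: det_mult[where n = k] det_tridiag Suc)
qed

section \<open>Alternating sums of elementary symmetric functions\<close>

text \<open>Split the subsets by whether they contain \<open>a\<close>; those that do have one more
  element, which shifts the argument of \<open>g\<close>.\<close>

lemma sum_Pow_insert_card:
  fixes f :: "'b \<Rightarrow> 'a::comm_ring_1" and g :: "int \<Rightarrow> 'a"
  assumes "finite A" "a \<notin> A"
  shows "(\<Sum>S\<in>Pow (insert a A). g (c - int (card S)) * prod f S) =
    (\<Sum>S\<in>Pow A. g (c - int (card S)) * prod f S) +
    f a * (\<Sum>S\<in>Pow A. g (c - 1 - int (card S)) * prod f S)"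
proof -
  have inj: "inj_on (insert a) (Pow A)"
    using assms by (intro inj_onI) (metis PowD insert_ident subset_iff)
  have fin: "finite S" "a \<notin> S" if "S \<in> Pow A" for S
    using that assms finite_subset by blast+
  have "(\<Sum>S\<in>Pow (insert a A). g (c - int (card S)) * prod f S) =
    (\<Sum>S\<in>Pow A. g (c - int (card S)) * prod f S) +
    (\<Sum>S\<in>insert a ` Pow A. g (c - int (card S)) * prod f S)"
    unfolding Pow_insert using assms by (intro sum.union_disjoint) auto
  also have "(\<Sum>S\<in>insert a ` Pow A. g (c - int (card S)) * prod f S) =
    (\<Sum>S\<in>Pow A. f a * (g (c - 1 - int (card S)) * prod f S))"
    by (subst sum.reindex[OF inj]) (auto intro!: sum.cong simp: fin algebra_simps)
  finally show ?thesis by (simp add: sum_distrib_left)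
qed

text \<open>With \<open>T\<close> the shift of degree by one, a new variable \<open>u\<close>
  contributes (1 + u T)(1 + T/u) = 1 + (u + 1/u) T + T^2. Moving the centre from \<open>n\<close> to
  \<open>Suc n\<close> makes this the symmetric recurrence of \<open>alt_conv\<close>.\<close>

lemma alt_conv_eq_sum_subsets:
  assumes "\<And>i. i \<in> {1..n} \<Longrightarrow> x i \<noteq> 0"
  shows "alt_conv K x n r = (\<Sum>S\<in>Pow ({1..n} \<times> {1, -1::int}).
    alt_char K (int n + r - int (card S)) * (\<Prod>(i, d)\<in>S. x i powi d))"
  using assms
proof (induction n arbitrary: r)
  case 0
  then show ?case by simp
next
  case (Suc n)
  let ?A = "{1..n} \<times> {1, -1::int}"
  let ?f = "\<lambda>(i, d). x i powi d"
  define G where "G A c = (\<Sum>S\<in>Pow A. alt_char K (c - int (card S)) * prod ?f S)"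
    for A :: "(nat \<times> int) set" and c
  have IH: "alt_conv K x n r = G ?A (int n + r)" for r
    unfolding G_def using Suc by simp
  have ins: "G (insert a A) c = G A c + ?f a * G A (c - 1)" if "finite A" "a \<notin> A" for a A c
    unfolding G_def by (rule sum_Pow_insert_card[OF that])
  have A: "{1..Suc n} \<times> {1, -1::int} = insert (Suc n, 1) (insert (Suc n, -1) ?A)"
    by (auto simp: atLeastAtMostSuc_conv)
  have "G ({1..Suc n} \<times> {1, -1::int}) c = G ?A c + inverse (x (Suc n)) * G ?A (c - 1)
     + x (Suc n) * (G ?A (c - 1) + inverse (x (Suc n)) * G ?A (c - 2))" for c
    unfolding A by (subst ins; simp; subst ins; simp)+
  moreover have "x (Suc n) * inverse (x (Suc n)) = 1"
    using Suc.prems[of "Suc n"] by simp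
  ultimately have "G ({1..Suc n} \<times> {1, -1::int}) c = G ?A c + (x (Suc n) + inverse (x (Suc n))) * G ?A (c - 1)
     + G ?A (c - 2)" for c
    by (simp add: algebra_simps flip: mult.assoc)
  then have "alt_conv K x (Suc n) r = G ({1..Suc n} \<times> {1, -1::int}) (int (Suc n) + r)"
    by (simp add: IH algebra_simps)
  then show ?case unfolding G_def .
qed

text \<open>After exchanging the sums, each subset \<open>S\<close> meets at most one
  \<open>z\<close>, and the sign of that \<open>z\<close> is the value of
  \<open>alt_char\<close>.\<close>

lemma sum_alternating_edot:
  assumes nz: "\<And>i. i \<in> {1..n} \<Longrightarrow> x i \<noteq> 0" and K: "K > 0"
    and N: "\<bar>r\<bar> \<le> N" "int n \<le> N"
  shows "(\<Sum>z\<in>{-(2*N)..2*N}. (-1) powi z * edot n x (int n + r - K * z)) = alt_conv K x n r"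
proof -
  let ?A = "{1..n} \<times> {1, -1::int}" and ?f = "\<lambda>(i, d). x i powi d"
  have "(\<Sum>z\<in>{-(2*N)..2*N}. (-1) powi z * edot n x (int n + r - K * z)) =
    (\<Sum>z\<in>{-(2*N)..2*N}. \<Sum>S\<in>Pow ?A. if int (card S) = int n + r - K * z then (-1) powi z * prod ?f S else 0)"
  proof (rule sum.cong)
    fix z
    have "{S. S \<subseteq> ?A \<and> int (card S) = int n + r - K * z} =
      {S \<in> Pow ?A. int (card S) = int n + r - K * z}" by auto
    then show "(-1) powi z * edot n x (int n + r - K * z) =
       (\<Sum>S\<in>Pow ?A. if int (card S) = int n + r - K * z then (-1) powi z * prod ?f S else 0)"
      by (simp add: edot_def sum.inter_filter[symmetric] sum_distrib_left)
  qed simp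
  also have "\<dots> = (\<Sum>S\<in>Pow ?A. \<Sum>z\<in>{-(2*N)..2*N}.
      if int (card S) = int n + r - K * z then (-1) powi z * prod ?f S else 0)"
    by (rule sum.swap)
  also have "\<dots> = (\<Sum>S\<in>Pow ?A. alt_char K (int n + r - int (card S)) * prod ?f S)"
  proof (rule sum.cong)
    fix S assume "S \<in> Pow ?A"
    then have "card S \<le> card ?A" by (intro card_mono) auto
    then have card: "int (card S) \<le> 2 * int n" by (simp add: card_cartesian_product)
    define m where "m = int n + r - int (card S)"
    have eq: "int (card S) = int n + r - K * z \<longleftrightarrow> m = K * z" for z
      unfolding m_def by auto
    show "(\<Sum>z\<in>{-(2*N)..2*N}. if int (card S) = int n + r - K * z then (-1) powi z * prod ?f S else 0)
      = alt_char K (int n + r - int (card S)) * prod ?f S"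
    proof (cases "K dvd m")
      case True
      then obtain q where q: "m = K * q" by blast
      \<comment> \<open>Since \<open>card S\<close> lies between 0 and 2n, \<open>m\<close> differs
        from \<open>r\<close> by at most \<open>n\<close>. This is where the range up to
        \<open>2 * N\<close> comes from.\<close>
      have "\<bar>m\<bar> \<le> 2 * N" using card N unfolding m_def by linarith
      moreover have "\<bar>q\<bar> \<le> \<bar>m\<bar>"
        using K by (simp add: q abs_mult mult_le_cancel_right1)
      ultimately have "q \<in> {-(2*N)..2*N}" by auto
      then show ?thesis unfolding eq using K by (simp add: m_def[symmetric] alt_char_def q)
    next
      case False
      then have "m \<noteq> K * z" for z by auto
      then show ?thesis unfolding eq using False by (simp add: m_def[symmetric] alt_char_def)
    qed
  qed simp
  also have "\<dots> = alt_conv K x n r"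
    using nz by (rule alt_conv_eq_sum_subsets[symmetric])
  finally show ?thesis .
qed

section \<open>Sums of determinants over integer vectors\<close>

text \<open>Each factor of a Leibniz term depends on one coordinate of \<open>y\<close> only, so
  summing over a box turns it into a product of sums. Outside the box a whole row vanishes.\<close>

lemma supp_sum_det_upto:
  fixes A :: "nat \<Rightarrow> nat \<Rightarrow> int \<Rightarrow> 'a::field"
  assumes "\<And>i j z. i \<in> {1..k} \<Longrightarrow> j \<in> {1..k} \<Longrightarrow> \<bar>z\<bar> > N \<Longrightarrow> A i j z = 0"
  shows "supp_sum (\<lambda>y. det_upto k (\<lambda>i j. A i j (y i))) (int_vecs k) =
    det_upto k (\<lambda>i j. \<Sum>z\<in>{-N..N}. A i j z)"
proof -
  let ?P = "{1..k} \<rightarrow>\<^sub>E {-N..N}"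
  let ?F = "\<lambda>y. det_upto k (\<lambda>i j. A i j (y i))"
  \<comment> \<open>The Leibniz product is reindexed by \<open>{1..k}\<close> to match the index set
    of \<open>y\<close>, while \<open>p\<close> still permutes \<open>{0..<k}\<close>.\<close>
  have det: "det_upto k B = (\<Sum>p | p permutes {0..<k}. signof p * (\<Prod>i\<in>{1..k}. B i (Suc (p (i - 1)))))"
    for B :: "nat \<Rightarrow> nat \<Rightarrow> 'a"
  proof -
    have "(\<Prod>a = 0..<k. mat k k (\<lambda>(a, b). B (Suc a) (Suc b)) $$ (a, p a)) =
        (\<Prod>i\<in>{1..k}. B i (Suc (p (i - 1))))" if p: "p permutes {0..<k}" for p
    proof (rule prod.reindex_bij_witness[of _ "\<lambda>i. i - 1" Suc])
      fix a assume "a \<in> {0..<k}"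
      moreover from this have "p a < k" using permutes_in_image[OF p, of a] by simp
      ultimately show "B (Suc a) (Suc (p (Suc a - 1))) = mat k k (\<lambda>(a, b). B (Suc a) (Suc b)) $$ (a, p a)"
        by simp
    qed auto
    then show ?thesis by (simp add: det_upto_def det_def)
  qed
  have zero: "?F y = 0" if "y \<notin> ?P" "y \<in> int_vecs k" for y
  proof -
    have "\<exists>i\<in>{1..k}. y i \<notin> {-N..N}"
      using that by (simp only: int_vecs_def PiE_iff) blast
    then obtain i where i: "i \<in> {1..k}" "\<bar>y i\<bar> > N"
      by (auto simp: abs_le_iff not_le[symmetric])
    have "(\<Prod>i\<in>{1..k}. A i (Suc (p (i - 1))) (y i)) = 0" if p: "p permutes {0..<k}" for p
    proof (rule prod_zero)
      have "p (i - 1) < k" using permutes_in_image[OF p, of "i - 1"] i by auto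
      then show "\<exists>i\<in>{1..k}. A i (Suc (p (i - 1))) (y i) = 0"
        using i assms by (intro bexI[of _ i]) auto
    qed simp
    then show ?thesis
      unfolding det by (intro sum.neutral ballI) (simp only: mem_Collect_eq mult_zero_right)
  qed
  have "supp_sum ?F (int_vecs k) = sum ?F ?P"
    unfolding supp_sum_def
  proof (rule sum.mono_neutral_left)
    show "finite ?P" by (intro finite_PiE) auto
    show "support_on (int_vecs k) ?F \<subseteq> ?P"
      using zero unfolding support_on_def by blast
    show "\<forall>i\<in>?P - support_on (int_vecs k) ?F. ?F i = 0"
      by (simp add: support_on_def int_vecs_def PiE_iff)
  qed
  also have "\<dots> = (\<Sum>p | p permutes {0..<k}. signof p *
     (\<Sum>y\<in>?P. \<Prod>i\<in>{1..k}. A i (Suc (p (i - 1))) (y i)))"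
    unfolding det sum_distrib_left by (rule sum.swap)
  also have "\<dots> = (\<Sum>p | p permutes {0..<k}. signof p *
     (\<Prod>i\<in>{1..k}. \<Sum>z\<in>{-N..N}. A i (Suc (p (i - 1))) z))"
    by (simp only: prod_sum_PiE finite_atLeastAtMost finite_atLeastAtMost_int)
  also have "\<dots> = det_upto k (\<lambda>i j. \<Sum>z\<in>{-N..N}. A i j z)"
    unfolding det ..
  finally show ?thesis .
qed

section \<open>Continuants as Laurent polynomials\<close>

text \<open>The Laurent polynomial \<open>u\<^bsup>-k\<^esup> + \<dots> + u\<^bsup>k\<^esup>\<close> (for \<open>u \<noteq> 1\<close>; division by zero gives \<open>0\<close> at \<open>u = 1\<close>).\<close>

definition laurent_geo :: "nat \<Rightarrow> 'a::field \<Rightarrow> 'a" where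
  "laurent_geo k u = (inverse u ^ k - u ^ Suc k) / (1 - u)"

lemma laurent_geo_0: "u \<noteq> 1 \<Longrightarrow> laurent_geo 0 u = 1"
  by (simp add: laurent_geo_def)

lemma laurent_geo_1:
  assumes "u \<noteq> 0" "u \<noteq> 1"
  shows "laurent_geo (Suc 0) u = u + inverse u + 1"
  using assms by (simp add: laurent_geo_def divide_eq_eq) (simp add: field_simps)

text \<open>Powers of \<open>u\<close> and of its inverse both satisfy this Chebyshev recurrence,
  hence so does the numerator; the denominator does not depend on \<open>k\<close>.\<close>

lemma laurent_geo_rec:
  assumes "u \<noteq> 0" "u \<noteq> 1"
  shows "(u + inverse u) * laurent_geo (Suc k) u - laurent_geo k u = laurent_geo (Suc (Suc k)) u"
proof -
  define v where "v = inverse u"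
  \<comment> \<open>The trailing factor \<open>w\<close> lets the cancellation apply inside
    right-nested products.\<close>
  have uv: "u * (v * w) = w" for w
    using assms by (simp add: v_def)
  have "(u + v) * (v ^ Suc k - u ^ Suc (Suc k)) - (v ^ k - u ^ Suc k) =
      v ^ Suc (Suc k) - u ^ Suc (Suc (Suc k))"
    by (simp add: algebra_simps uv)
  then show ?thesis
    unfolding laurent_geo_def v_def[symmetric]
    by (metis diff_divide_distrib times_divide_eq_right)
qed

text \<open>A corner at the first index affects only the initial value, so both sides share
  recurrence and initial values.\<close>

lemma continuant_first_corner:
  assumes "u \<noteq> 0" "u \<noteq> 1"
  shows "continuant (\<lambda>b. u + inverse u + (if b = 0 then 1 else 0)) k = laurent_geo k u"
  using assms
  by (induction k rule: induct_nat_012)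
    (simp_all add: laurent_geo_0 laurent_geo_1 laurent_geo_rec)

text \<open>The constant continuant is the Chebyshev polynomial of the second kind, with exponents
  -k, -k+2, ..., k; two consecutive ones interlace to fill all exponents.\<close>

lemma continuant_const_add:
  assumes "u \<noteq> 0" "u \<noteq> 1"
  shows "continuant (\<lambda>_. u + inverse u) (Suc k) + continuant (\<lambda>_. u + inverse u) k = laurent_geo (Suc k) u"
proof (induction k rule: induct_nat_012)
  case 0
  then show ?case using assms by (simp add: laurent_geo_1)
next
  case 1
  then show ?case
    using laurent_geo_rec[OF assms, of 0] assms
    by (simp add: laurent_geo_1 laurent_geo_0 algebra_simps)
next
  case (ge2 k)
  show ?case
    using laurent_geo_rec[OF assms, of "Suc k"]
    unfolding ge2[symmetric] by (simp add: algebra_simps)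
qed

text \<open>The corner enters only the last step of the recurrence, where it adds the previous
  constant continuant.\<close>

lemma continuant_last_corner:
  assumes "u \<noteq> 0" "u \<noteq> 1"
  shows "continuant (\<lambda>b. u + inverse u + (if Suc b = k then 1 else 0)) k = laurent_geo k u"
proof -
  consider (1) "k = 0" | (2) "k = Suc 0" | (3) m where "k = Suc (Suc m)"
    by (metis not0_implies_Suc)
  then show ?thesis
  proof cases
    case 1
    then show ?thesis using assms by (simp add: laurent_geo_0)
  next
    case 2
    then show ?thesis using assms by (simp add: laurent_geo_1)
  next
    case (3 m)
    let ?T = "continuant (\<lambda>_. u + inverse u)"
    have "continuant (\<lambda>b. u + inverse u + (if Suc b = k then 1 else 0)) m = ?T m"
      "continuant (\<lambda>b. u + inverse u + (if Suc b = k then 1 else 0)) (Suc m) = ?T (Suc m)"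
      by (rule continuant_cong; simp add: 3)+
    then show ?thesis
      using continuant_const_add[OF assms, of "Suc m"] by (simp add: 3 algebra_simps)
  qed
qed

section \<open>Hall-Littlewood polynomials at t = 1\<close>

text \<open>Cancelling the powers of 1 - t before evaluation leaves the product of the 1 + t + ... +
  t^i for \<open>i < m\<close>, whose factors are \<open>i + 1\<close> at t = 1.\<close>

lemma poly_qfact_poly_1: "poly (qfact_poly m) 1 = (fact m :: 'a::field_char_0)"
proof -
  let ?X = "[:0, 1:] :: 'a poly"
  have "1 - ?X * ?X ^ i = (1 - ?X) * (\<Sum>j\<le>i. ?X ^ j)" for i
    using one_diff_power_eq[of ?X "Suc i"] by (simp only: power_Suc lessThan_Suc_atMost)
  then have "qpoch ?X ?X m = (\<Prod>i<m. \<Sum>j\<le>i. ?X ^ j) * (1 - ?X) ^ m"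
    by (simp only: qpoch_def prod.distrib prod_constant card_lessThan mult.commute)
  then have "qfact_poly m * (1 - ?X) ^ m = (\<Prod>i<m. \<Sum>j\<le>i. ?X ^ j) * (1 - ?X) ^ m"
    by (simp only: qfact_poly_exact)
  moreover have "(1 - ?X) ^ m \<noteq> 0"
    by (simp add: one_pCons)
  ultimately have "qfact_poly m = (\<Prod>i<m. \<Sum>j\<le>i. ?X ^ j)"
    by (metis mult_right_cancel)
  then show ?thesis
    by (simp add: poly_prod poly_sum fact_prod_Suc lessThan_atLeast0 add.commute)
qed

text \<open>The factorial comes from the factor for the missing parts if \<open>k = 0\<close>, and
  from the multiplicity of the part \<open>k\<close> otherwise.\<close>

lemma poly_hl_v_rect_part:
  assumes "n \<ge> 1"
  shows "poly (hl_v n (rect_part k n)) 1 = (fact n :: 'a::field_char_0)"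
proof (cases "k = 0")
  case True
  have "part_length (rect_part k n) = 0" "\<And>i. i \<ge> 1 \<Longrightarrow> part_mult (rect_part k n) i = 0"
    by (auto simp: part_length_def part_mult_def rect_part_def True)
  then have "hl_v n (rect_part k n) = (qfact_poly n :: 'a poly)"
    by (simp add: hl_v_def cong: conj_cong)
  then show ?thesis by (simp add: poly_qfact_poly_1)
next
  case False
  have "{j. j \<ge> 1 \<and> rect_part k n j \<noteq> 0} = {1..n}"
    using False by (auto simp: rect_part_def)
  then have len: "part_length (rect_part k n) = n"
    by (simp add: part_length_def)
  have "{j. j \<ge> 1 \<and> rect_part k n j = i} = (if i = k then {1..n} else {})" if "i \<ge> 1" for i
    using that False by (auto simp: rect_part_def)
  then have mult: "part_mult (rect_part k n) i = (if i = k then n else 0)" if "i \<ge> 1" for i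
    using that by (simp add: part_mult_def)
  then have "{i. i \<ge> 1 \<and> part_mult (rect_part k n) i \<noteq> 0} = {k}"
    using assms False by (auto split: if_splits)
  moreover have "part_mult (rect_part k n) k = n"
    using False mult[of k] by simp
  ultimately show ?thesis
    by (simp add: hl_v_def len poly_qfact_poly_1)
qed

text \<open>The pair factors cancel to 1. The conditions on \<open>s1\<close> and \<open>s2\<close>
  fit both parameter pairs (0, -1) and (-1, 0) and turn the numerator into \<open>1 + y i\<close>,
  which cancels against \<open>1 - y i ^ 2\<close>.\<close>

lemma hl_kernel_t1:
  assumes s: "s1 * s2 = 0" "s1 + s2 = -1"
    and sq: "\<And>i. i \<in> {1..n} \<Longrightarrow> y i ^ 2 \<noteq> 1"
    and neq: "\<And>i j. i \<in> {1..n} \<Longrightarrow> j \<in> {1..n} \<Longrightarrow> i \<noteq> j \<Longrightarrow> y i \<noteq> y j \<and> y i * y j \<noteq> 1"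
  shows "hl_kernel n (rect_part k n) 1 s1 s2 y = (\<Prod>i=1..n. y i powi (- int k) / (1 - y i))"
proof -
  have "(\<Prod>(i, j) | 1 \<le> i \<and> i < j \<and> j \<le> n.
      (1 * y i - y j) * (1 - 1 * y i * y j) / ((y i - y j) * (1 - y i * y j))) = 1"
    using neq by (intro prod.neutral) auto
  moreover have "y i powi (- int (rect_part k n i)) * ((1 - s1 * y i) * (1 - s2 * y i) / (1 - y i ^ 2))
      = y i powi (- int k) / (1 - y i)" if i: "i \<in> {1..n}" for i
  proof -
    have "(1 - s1 * y i) * (1 - s2 * y i) = 1 - (s1 + s2) * y i + (s1 * s2) * y i ^ 2"
      by (simp add: algebra_simps power2_eq_square)
    also have "\<dots> = 1 + y i" by (simp add: s)
    finally have num: "(1 - s1 * y i) * (1 - s2 * y i) = 1 + y i" .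
    have den: "1 - y i ^ 2 = (1 + y i) * (1 - y i)"
      by (simp add: algebra_simps power2_eq_square)
    moreover have "1 + y i \<noteq> 0"
      using sq[OF i] den by auto
    ultimately show ?thesis
      using i by (simp add: num rect_part_def)
  qed
  ultimately show ?thesis
    unfolding hl_kernel_def by simp
qed

text \<open>The sum over sign choices factors over the variables, and every permutation gives the
  same product. The resulting \<open>fact n\<close> cancels the value of
  \<open>hl_v\<close>.\<close>

lemma hl_BC_rect_part_t1:
  fixes x :: "nat \<Rightarrow> 'a::field_char_0"
  assumes n: "n \<ge> 1" and s: "s1 * s2 = 0" "s1 + s2 = -1"
    and x: "\<And>i. i \<in> {1..n} \<Longrightarrow> x i \<noteq> 0 \<and> x i ^ 2 \<noteq> 1"
    and neq: "\<And>i j. i \<in> {1..n} \<Longrightarrow> j \<in> {1..n} \<Longrightarrow> i \<noteq> j \<Longrightarrow> x i \<noteq> x j \<and> x i * x j \<noteq> 1"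
  shows "hl_BC n (rect_part k n) x 1 s1 s2 = (\<Prod>i=1..n. laurent_geo k (x i))"
proof -
  define h where "h u = u powi (- int k) / (1 - u)" for u :: 'a
  let ?D = "{1..n} \<rightarrow>\<^sub>E {1, -1::int}"
  have h: "h u + h (inverse u) = laurent_geo k u" if "u \<noteq> 0" "u ^ 2 \<noteq> 1" for u
  proof -
    have "u \<noteq> 1" using that by auto
    have "h (inverse u) = u ^ k / (1 - inverse u)"
      by (simp add: h_def power_int_minus power_inverse)
    also have "\<dots> = - (u ^ Suc k) / (1 - u)"
      using \<open>u \<noteq> 0\<close> \<open>u \<noteq> 1\<close> by (simp add: field_simps)
    finally show ?thesis
      by (simp add: h_def laurent_geo_def power_int_minus power_inverse diff_divide_distrib)
  qed
  \<comment> \<open>The nondegeneracy conditions are stable under the group, so the kernel splits at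
    every group element.\<close>
  have kernel: "hyperoct_act (p, d) (hl_kernel n (rect_part k n) 1 s1 s2) x =
      (\<Prod>i=1..n. h (x (p i) powi d i))" if p: "p permutes {1..n}" and d: "d \<in> ?D" for p d
  proof -
    have pi: "p i \<in> {1..n}" if "i \<in> {1..n}" for i
      using permutes_in_image[OF p] that by blast
    have di: "d i = 1 \<or> d i = -1" if "i \<in> {1..n}" for i
      using PiE_mem[OF d that] by auto
    have "(x (p i) powi d i) ^ 2 \<noteq> 1" if i: "i \<in> {1..n}" for i
      using di[OF i] x[OF pi[OF i]] by (auto simp: power_int_minus power_inverse)
    moreover have "x (p i) powi d i \<noteq> x (p j) powi d j \<and> x (p i) powi d i * x (p j) powi d j \<noteq> 1"
      if i: "i \<in> {1..n}" and j: "j \<in> {1..n}" and "i \<noteq> j" for i j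
    proof -
      have "p i \<noteq> p j" using \<open>i \<noteq> j\<close> permutes_inj[OF p] by (auto dest: injD)
      then have "x (p i) \<noteq> x (p j)" "x (p i) * x (p j) \<noteq> 1"
        using neq[OF pi[OF i] pi[OF j]] by auto
      then show ?thesis
        using di[OF i] di[OF j] x[OF pi[OF i]] x[OF pi[OF j]]
        by (auto simp: power_int_minus field_simps)
    qed
    ultimately show ?thesis
      unfolding hyperoct_act_def h_def prod.case by (rule hl_kernel_t1[OF s])
  qed
  have "(\<Sum>d\<in>?D. \<Prod>i=1..n. h (x (p i) powi d i)) = (\<Prod>i=1..n. laurent_geo k (x i))"
    if p: "p permutes {1..n}" for p
  proof -
    have "(\<Sum>d\<in>?D. \<Prod>i=1..n. h (x (p i) powi d i)) = (\<Prod>i=1..n. \<Sum>e\<in>{1, -1}. h (x (p i) powi e))"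
      by (subst prod_sum_PiE) simp_all
    also have "\<dots> = (\<Prod>i=1..n. laurent_geo k (x (p i)))"
    proof (rule prod.cong)
      fix i assume "i \<in> {1..n}"
      then have "p i \<in> {1..n}" using permutes_in_image[OF p] by blast
      then show "(\<Sum>e\<in>{1, -1}. h (x (p i) powi e)) = laurent_geo k (x (p i))"
        using h[of "x (p i)"] x by (simp add: power_int_minus)
    qed simp
    also have "\<dots> = (\<Prod>i=1..n. laurent_geo k (x i))"
      using prod.permute[OF p, of "\<lambda>i. laurent_geo k (x i)"] by (simp add: comp_def)
    finally show ?thesis .
  qed
  moreover have "(\<Sum>w\<in>hyperoct n. hyperoct_act w (hl_kernel n (rect_part k n) 1 s1 s2) x) =
      (\<Sum>p | p permutes {1..n}. \<Sum>d\<in>?D. \<Prod>i=1..n. h (x (p i) powi d i))"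
    unfolding hyperoct_def sum.cartesian_product
    by (rule sum.cong) (auto simp: kernel)
  ultimately have "(\<Sum>w\<in>hyperoct n. hyperoct_act w (hl_kernel n (rect_part k n) 1 s1 s2) x) =
      fact n * (\<Prod>i=1..n. laurent_geo k (x i))"
    using card_permutations[of "{1..n}" n] by simp
  then show ?thesis
    by (simp add: hl_BC_def s qpoch_def poly_hl_v_rect_part[OF n])
qed

section \<open>Evaluation of the two determinant sums\<close>

text \<open>The scalar \<open>c\<close> is the sign distinguishing the two identities. As the
  offsets \<open>f\<close> and \<open>g\<close> are bounded by \<open>2k\<close>, one truncation of
  \<open>z\<close> serves all entries.\<close>

lemma supp_sum_det_upto_edot:
  fixes x :: "nat \<Rightarrow> 'a::field_char_0" and f g :: "nat \<Rightarrow> nat \<Rightarrow> int"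
  assumes x: "\<And>i. i \<in> {1..n} \<Longrightarrow> x i \<noteq> 0" and K: "K > 0"
    and f: "\<And>i j. i \<in> {1..k} \<Longrightarrow> j \<in> {1..k} \<Longrightarrow> \<bar>f i j\<bar> \<le> 2 * int k"
    and g: "\<And>i j. i \<in> {1..k} \<Longrightarrow> j \<in> {1..k} \<Longrightarrow> \<bar>g i j\<bar> \<le> 2 * int k"
  shows "supp_sum (\<lambda>y. det_upto k (\<lambda>i j. (-1) powi (y i) *
      (edot n x (int n + f i j - K * y i) + c * edot n x (int n + g i j - K * y i)))) (int_vecs k)
    = det_upto k (\<lambda>i j. alt_conv K x n (f i j) + c * alt_conv K x n (g i j))"
proof -
  define N where "N = int n + 2 * int k"
  have zero: "edot n x (int n + r - K * z) = 0" if r: "\<bar>r\<bar> \<le> 2 * int k" and z: "\<bar>z\<bar> > 2 * N" for r z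
  proof (rule edot_eq_0)
    have "\<bar>K * z\<bar> \<ge> \<bar>z\<bar>"
      using K by (simp add: abs_mult mult_le_cancel_right1)
    then have "2 * N < \<bar>K * z\<bar>"
      using z by (rule less_le_trans[rotated])
    then have "K * z > 2 * N \<or> K * z < - (2 * N)"
      by (auto simp: abs_if split: if_splits)
    \<comment> \<open>The first bound makes the index negative for large \<open>K * z\<close>; the
      second pushes it above 2n at the other end.\<close>
    moreover have "2 * N \<ge> int n + r" "2 * N \<ge> int n - r"
      using r unfolding N_def abs_le_iff by simp_all
    ultimately show "int n + r - K * z < 0 \<or> int n + r - K * z > 2 * int n"
      by linarith
  qed
  have sum: "(\<Sum>z\<in>{-(2*N)..2*N}. (-1) powi z * edot n x (int n + r - K * z)) = alt_conv K x n r"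
    if "\<bar>r\<bar> \<le> 2 * int k" for r
    using that by (intro sum_alternating_edot x K) (auto simp: N_def)
  have "supp_sum (\<lambda>y. det_upto k (\<lambda>i j. (-1) powi (y i) *
      (edot n x (int n + f i j - K * y i) + c * edot n x (int n + g i j - K * y i)))) (int_vecs k)
    = det_upto k (\<lambda>i j. \<Sum>z\<in>{-(2*N)..2*N}. (-1) powi z *
      (edot n x (int n + f i j - K * z) + c * edot n x (int n + g i j - K * z)))"
    by (rule supp_sum_det_upto) (simp add: zero f g)
  also have "\<dots> = det_upto k (\<lambda>i j. alt_conv K x n (f i j) + c * alt_conv K x n (g i j))"
    unfolding det_upto_def
  proof (intro arg_cong[of _ _ det] cong_mat)
    fix a b assume "a < k" "b < k"
    then have "Suc a \<in> {1..k}" "Suc b \<in> {1..k}" by auto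
    then show "(\<lambda>(a, b). \<Sum>z\<in>{-(2*N)..2*N}. (-1) powi z *
        (edot n x (int n + f (Suc a) (Suc b) - K * z) + c * edot n x (int n + g (Suc a) (Suc b) - K * z))) (a, b) =
      (\<lambda>(a, b). alt_conv K x n (f (Suc a) (Suc b)) + c * alt_conv K x n (g (Suc a) (Suc b))) (a, b)"
      using sum[OF f, of "Suc a" "Suc b"] sum[OF g, of "Suc a" "Suc b"]
      by (simp add: distrib_left sum.distrib mult.left_commute[of _ c] flip: sum_distrib_left)
  qed simp_all
  finally show ?thesis .
qed

theorem lemma4p4:
  fixes x :: "nat \<Rightarrow> 'a::field_char_0" and k n :: nat and K :: int
  assumes "n \<ge> 1"
    and "K = 2 * int k + 1"
    and "\<And>i. i \<in> {1..n} \<Longrightarrow> x i \<noteq> 0 \<and> x i ^ 2 \<noteq> 1"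
    and "\<And>i j. i \<in> {1..n} \<Longrightarrow> j \<in> {1..n} \<Longrightarrow> i \<noteq> j \<Longrightarrow> x i \<noteq> x j \<and> x i * x j \<noteq> 1"
  shows "hl_B n (rect_part k n) x 1 0 =
      supp_sum (\<lambda>y. det_upto k (\<lambda>i j. (-1) powi (y i) *
          (edot n x (int n - int i + int j - K * y i)
           + edot n x (int n + int i + int j - K * y i - 1)))) (int_vecs k)
    \<and> hl_BC n (rect_part k n) x 1 (-1) 0 =
      supp_sum (\<lambda>y. det_upto k (\<lambda>i j. (-1) powi (y i) *
          (edot n x (int n - int i + int j - K * y i)
           - edot n x (int n + int i + int j - K * y i)))) (int_vecs k)"
proof -
  let ?E = "alt_conv K x"
  have K: "K > 0" "K \<noteq> 0" using assms(2) by auto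
  have x: "x i \<noteq> 0" "x i \<noteq> 1" if "i \<in> {1..n}" for i
    using assms(3)[OF that] by auto
  have supp: "supp_sum (\<lambda>y. det_upto k (\<lambda>i j. (-1) powi (y i) *
      (edot n x (int n + (int j - int i) - K * y i) + c * edot n x (int n + g i j - K * y i)))) (int_vecs k)
    = det_upto k (\<lambda>i j. ?E n (int j - int i) + c * ?E n (g i j))"
    if "\<And>i j. i \<in> {1..k} \<Longrightarrow> j \<in> {1..k} \<Longrightarrow> \<bar>g i j\<bar> \<le> 2 * int k" for c g
    by (rule supp_sum_det_upto_edot) (use that x K in auto)

  \<comment> \<open>Indices are zero-based here, \<open>i = a + 1\<close> and
    \<open>j = r + 1\<close>, so \<open>i + j - 1\<close> becomes \<open>r + a + 1\<close>.\<close>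
  define m1 where "m1 n a r = ?E n (r - int a) + ?E n (r + int a + 1)" for n a r
  have "det (mat k k (\<lambda>(a, b). m1 n a (int b))) = (\<Prod>i=1..n. continuant
      (\<lambda>b. (x i + inverse (x i)) + (if b = 0 then 1 else 0) + (if Suc b = k then 0 else 0)) k)"
  proof (rule det_prod_tridiag)
    show "m1 0 a (int b) = (if a = b then 1 else 0)" if "a < k" "b < k" for a b
      using that by (simp add: m1_def alt_char_small assms(2))
    show "m1 (Suc n) a r = (x (Suc n) + inverse (x (Suc n))) * m1 n a r + m1 n a (r - 1) + m1 n a (r + 1)"
      for n a r
      by (simp add: m1_def algebra_simps)
    \<comment> \<open>Evenness exchanges the two summands, which puts a 1 in the first
      corner.\<close>
    show "m1 n a (-1) = 1 * m1 n a 0" for n a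
      using alt_conv_minus[of K x n "int a"] alt_conv_minus[of K x n "int a + 1"]
      by (simp add: m1_def algebra_simps)
    \<comment> \<open>The arguments \<open>k - a\<close> and \<open>k + a + 1\<close> add up to
      \<open>K\<close>, so the summands cancel.\<close>
    show "m1 n a (int k) = 0 * m1 n a (int k - 1)" for n a
      using alt_conv_reflect[OF K(2), of x n "int k - int a"]
      by (simp add: m1_def assms(2) algebra_simps)
  qed
  then have det1: "det (mat k k (\<lambda>(a, b). m1 n a (int b))) = (\<Prod>i=1..n. laurent_geo k (x i))"
    using x by (simp add: continuant_first_corner)
  have "supp_sum (\<lambda>y. det_upto k (\<lambda>i j. (-1) powi (y i) *
          (edot n x (int n - int i + int j - K * y i)
           + edot n x (int n + int i + int j - K * y i - 1)))) (int_vecs k)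
    = det_upto k (\<lambda>i j. ?E n (int j - int i) + 1 * ?E n (int i + int j - 1))"
    by (subst supp[symmetric]) (auto simp: algebra_simps)
  also have "\<dots> = (\<Prod>i=1..n. laurent_geo k (x i))"
    unfolding det1[symmetric] det_upto_def by (simp add: m1_def algebra_simps)
  finally have first: "supp_sum (\<lambda>y. det_upto k (\<lambda>i j. (-1) powi (y i) *
          (edot n x (int n - int i + int j - K * y i)
           + edot n x (int n + int i + int j - K * y i - 1)))) (int_vecs k)
    = (\<Prod>i=1..n. laurent_geo k (x i))" .

  \<comment> \<open>Now \<open>i + j\<close> becomes \<open>r + a + 2\<close>, and the roles of the
    two ends are exchanged.\<close>
  define m2 where "m2 n a r = ?E n (r - int a) - ?E n (r + int a + 2)" for n a r
  have "det (mat k k (\<lambda>(a, b). m2 n a (int b))) = (\<Prod>i=1..n. continuant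
      (\<lambda>b. (x i + inverse (x i)) + (if b = 0 then 0 else 0) + (if Suc b = k then 1 else 0)) k)"
  proof (rule det_prod_tridiag)
    show "m2 0 a (int b) = (if a = b then 1 else 0)" if "a < k" "b < k" for a b
      using that by (simp add: m2_def alt_char_small assms(2))
    show "m2 (Suc n) a r = (x (Suc n) + inverse (x (Suc n))) * m2 n a r + m2 n a (r - 1) + m2 n a (r + 1)"
      for n a r
      by (simp add: m2_def algebra_simps)
    show "m2 n a (-1) = 0 * m2 n a 0" for n a
      using alt_conv_minus[of K x n "int a + 1"]
      by (simp add: m2_def algebra_simps)
    \<comment> \<open>Reflection sends \<open>k - a\<close> to \<open>k + a + 1\<close> and
      \<open>k - 1 - a\<close> to \<open>k + a + 2\<close>, so columns \<open>k - 1\<close> and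
      \<open>k\<close> agree.\<close>
    show "m2 n a (int k) = 1 * m2 n a (int k - 1)" for n a
      using alt_conv_reflect[OF K(2), of x n "int k - int a"]
        alt_conv_reflect[OF K(2), of x n "int k - 1 - int a"]
      by (simp add: m2_def assms(2) algebra_simps)
  qed
  then have det2: "det (mat k k (\<lambda>(a, b). m2 n a (int b))) = (\<Prod>i=1..n. laurent_geo k (x i))"
    using x by (simp add: continuant_last_corner)
  have "supp_sum (\<lambda>y. det_upto k (\<lambda>i j. (-1) powi (y i) *
          (edot n x (int n - int i + int j - K * y i)
           - edot n x (int n + int i + int j - K * y i)))) (int_vecs k)
    = det_upto k (\<lambda>i j. ?E n (int j - int i) + (-1) * ?E n (int i + int j))"
    by (subst supp[symmetric]) (auto simp: algebra_simps)
  also have "\<dots> = (\<Prod>i=1..n. laurent_geo k (x i))"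
    unfolding det2[symmetric] det_upto_def by (simp add: m2_def algebra_simps)
  finally have second: "supp_sum (\<lambda>y. det_upto k (\<lambda>i j. (-1) powi (y i) *
          (edot n x (int n - int i + int j - K * y i)
           - edot n x (int n + int i + int j - K * y i)))) (int_vecs k)
    = (\<Prod>i=1..n. laurent_geo k (x i))" .

  show ?thesis
    unfolding first second hl_B_def
    using assms by (intro conjI hl_BC_rect_part_t1) auto
qed

end
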